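(* Let $n\ge 3$ and let $F_n^2$ be the complex Leibniz algebra with basis $\{e_1,\dots,e_n\}$ and $[e_1,e_1]=e_3$, $[e_i,e_1]=e_{i+1}$ for $3\le i\le n-1$. Every four-dimensional non-split central extension of $F_n^2$ is isomorphic to the following algebra with basis $\{e_1,\dots,e_{n+4}\}$: $$\left\{\begin{array}{ll}[e_i,e_1]=e_{i+1},&1\le i\le n-2,\\ [e_{n-1},e_1]=e_{n+2},&\\ [e_n,e_1]=e_{n+1},&\\ [e_1,e_n]=e_{n+3},&\\ [e_n,e_n]=e_{n+4}.&\end{array}\right.$$
   Context: All vector spaces and algebras are finite-dimensional over $\mathbb{C}$; in multiplication tables omitted products of basis elements are zero. A Leibniz algebra is an algebra $L$ with bilinear product satisfying $[x,[y,z]]=[[x,y],z]-[[x,z],y]$. A $k$-dimensional central extension of a Leibniz algebra $L$ is a Leibniz algebra $\widehat L$ fitting into a short exact sequence of Leibniz algebras $0\to V\to\widehat L\to L\to0$ with $\dim V=k$ and the image of $V$ contained in the center of $\widehat L$; equivalently $\widehat L\cong L\oplus V$ with product $[x+u,y+v]=[x,y]_L+\theta(x,y)$, where $\theta:L\times L\to V$ is bilinear with $\theta(x,[y,z])=\theta([x,y],z)-\theta([x,z],y)$. A $k$-dimensional central extension of $L$ is split if, as an algebra, it is isomorphic to $L'\oplus\mathbb{C}$, where $L'$ is a $(k-1)$-dimensional central extension of $L$ and $\mathbb{C}$ is the one-dimensional abelian algebra; otherwise it is non-split. *)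

theory Defs
  imports Complex_Main "HOL-Library.Function_Algebras" "HOL-Library.Product_Plus"
begin

text \<open>
  An algebra is carried by a complex subspace of an ambient vector space: the underlying set
  need not be the whole type, so that algebras of varying dimension share one type.
\<close>

record 'a calg =
  carr :: "'a set"
  scl :: "complex \<Rightarrow> 'a \<Rightarrow> 'a"
  brk :: "'a \<Rightarrow> 'a \<Rightarrow> 'a"

definition fd_algebra :: "('a::ab_group_add) calg \<Rightarrow> bool" where
  "fd_algebra A \<longleftrightarrow>
     vector_space (scl A) \<and>
     module.subspace (scl A) (carr A) \<and>
     (\<exists>B. finite B \<and> carr A = module.span (scl A) B) \<and>
     (\<forall>x\<in>carr A. \<forall>y\<in>carr A. brk A x y \<in> carr A) \<and>
     (\<forall>x\<in>carr A. \<forall>y\<in>carr A. \<forall>z\<in>carr A.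
        brk A (x + y) z = brk A x z + brk A y z \<and>
        brk A x (y + z) = brk A x y + brk A x z) \<and>
     (\<forall>c. \<forall>x\<in>carr A. \<forall>y\<in>carr A.
        brk A (scl A c x) y = scl A c (brk A x y) \<and>
        brk A x (scl A c y) = scl A c (brk A x y))"

definition leibniz_algebra :: "('a::ab_group_add) calg \<Rightarrow> bool" where
  "leibniz_algebra A \<longleftrightarrow>
     fd_algebra A \<and>
     (\<forall>x\<in>carr A. \<forall>y\<in>carr A. \<forall>z\<in>carr A.
        brk A x (brk A y z) = brk A (brk A x y) z - brk A (brk A x z) y)"

definition alg_dim :: "('a::ab_group_add) calg \<Rightarrow> nat" where
  "alg_dim A = vector_space.dim (scl A) (carr A)"

definition alg_center :: "('a::ab_group_add) calg \<Rightarrow> 'a set" where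
  "alg_center A = {z \<in> carr A. \<forall>x\<in>carr A. brk A x z = 0 \<and> brk A z x = 0}"

definition alg_hom ::
    "('a::ab_group_add) calg \<Rightarrow> ('b::ab_group_add) calg \<Rightarrow> ('a \<Rightarrow> 'b) \<Rightarrow> bool" where
  "alg_hom A B f \<longleftrightarrow>
     (\<forall>x\<in>carr A. f x \<in> carr B) \<and>
     (\<forall>x\<in>carr A. \<forall>y\<in>carr A. f (x + y) = f x + f y) \<and>
     (\<forall>c. \<forall>x\<in>carr A. f (scl A c x) = scl B c (f x)) \<and>
     (\<forall>x\<in>carr A. \<forall>y\<in>carr A. f (brk A x y) = brk B (f x) (f y))"

definition alg_iso ::
    "('a::ab_group_add) calg \<Rightarrow> ('b::ab_group_add) calg \<Rightarrow> bool" (infix "\<cong>\<^sub>a" 50) where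
  "A \<cong>\<^sub>a B \<longleftrightarrow> (\<exists>f. alg_hom A B f \<and> bij_betw f (carr A) (carr B))"

definition direct_sum ::
    "('a::ab_group_add) calg \<Rightarrow> ('b::ab_group_add) calg \<Rightarrow> ('a \<times> 'b) calg" (infixr "\<oplus>\<^sub>a" 65) where
  "A \<oplus>\<^sub>a B =
     \<lparr>carr = carr A \<times> carr B,
      scl = (\<lambda>c (u, v). (scl A c u, scl B c v)),
      brk = (\<lambda>(u, v) (u', v'). (brk A u u', brk B v v'))\<rparr>"

definition abelian_C :: "complex calg" where
  "abelian_C = \<lparr>carr = UNIV, scl = (*), brk = (\<lambda>_ _. 0)\<rparr>"

definition short_exact ::
    "('v::ab_group_add) calg \<Rightarrow> ('v \<Rightarrow> 'a) \<Rightarrow> ('a::ab_group_add) calg \<Rightarrow> ('a \<Rightarrow> 'b) \<Rightarrow>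
     ('b::ab_group_add) calg \<Rightarrow> bool" where
  "short_exact V i E p L \<longleftrightarrow>
     leibniz_algebra V \<and> leibniz_algebra E \<and> leibniz_algebra L \<and>
     alg_hom V E i \<and> alg_hom E L p \<and>
     inj_on i (carr V) \<and>
     i ` carr V = {x \<in> carr E. p x = 0} \<and>
     p ` carr E = carr L"

text \<open>
  Letting \<open>V\<close> range over algebras on the type of \<open>E\<close> loses no generality, since \<open>V\<close> embeds
  into \<open>E\<close>.
\<close>

definition central_extension ::
    "nat \<Rightarrow> ('a::ab_group_add) calg \<Rightarrow> ('b::ab_group_add) calg \<Rightarrow> bool" where
  "central_extension k E L \<longleftrightarrow>
     (\<exists>(V :: 'a calg) i p.
        short_exact V i E p L \<and> alg_dim V = k \<and> i ` carr V \<subseteq> alg_center E)"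

text \<open>
  Every finite-dimensional complex algebra is isomorphic to one carried by a subspace of
  \<open>nat \<Rightarrow> complex\<close>, so \<open>L'\<close> may be sought on that type.
\<close>

definition split_extension ::
    "nat \<Rightarrow> ('a::ab_group_add) calg \<Rightarrow> ('b::ab_group_add) calg \<Rightarrow> bool" where
  "split_extension k E L \<longleftrightarrow>
     central_extension k E L \<and>
     (\<exists>k' (L' :: (nat \<Rightarrow> complex) calg).
        k = Suc k' \<and> central_extension k' L' L \<and> E \<cong>\<^sub>a L' \<oplus>\<^sub>a abelian_C)"

definition nonsplit_extension ::
    "nat \<Rightarrow> ('a::ab_group_add) calg \<Rightarrow> ('b::ab_group_add) calg \<Rightarrow> bool" where
  "nonsplit_extension k E L \<longleftrightarrow> central_extension k E L \<and> \<not> split_extension k E L"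

definition basis_e :: "nat \<Rightarrow> nat \<Rightarrow> complex" where
  "basis_e i = (\<lambda>j. if j = i then 1 else 0)"

text \<open>
  The algebra with basis \<open>basis_e 1, \<dots>, basis_e d\<close> and \<open>[basis_e i, basis_e j] = t i j\<close>,
  extended bilinearly.
\<close>

definition table_algebra :: "nat \<Rightarrow> (nat \<Rightarrow> nat \<Rightarrow> nat \<Rightarrow> complex) \<Rightarrow> (nat \<Rightarrow> complex) calg" where
  "table_algebra d t =
     \<lparr>carr = {x. \<forall>i. i \<notin> {1..d} \<longrightarrow> x i = 0},
      scl = (\<lambda>c x i. c * x i),
      brk = (\<lambda>x y k. \<Sum>i=1..d. \<Sum>j=1..d. x i * y j * t i j k)\<rparr>"

definition F2 :: "nat \<Rightarrow> (nat \<Rightarrow> complex) calg" where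
  "F2 n = table_algebra n (\<lambda>i j.
     if i = 1 \<and> j = 1 then basis_e 3
     else if 3 \<le> i \<and> i \<le> n - 1 \<and> j = 1 then basis_e (i + 1)
     else 0)"

definition ext4_F2 :: "nat \<Rightarrow> (nat \<Rightarrow> complex) calg" where
  "ext4_F2 n = table_algebra (n + 4) (\<lambda>i j.
     if 1 \<le> i \<and> i \<le> n - 2 \<and> j = 1 then basis_e (i + 1)
     else if i = n - 1 \<and> j = 1 then basis_e (n + 2)
     else if i = n \<and> j = 1 then basis_e (n + 1)
     else if i = 1 \<and> j = n then basis_e (n + 3)
     else if i = n \<and> j = n then basis_e (n + 4)
     else 0)"

end

theory Submission
  imports Defs
begin

text \<open>
  Let \<open>p\<close> be the projection of a central extension \<open>E\<close> of \<open>F2 n\<close> onto \<open>F2 n\<close>, with kernel \<open>K\<close>, and let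
  \<open>a\<close> and \<open>b\<close> be lifts of \<open>e\<^sub>1\<close> and \<open>e\<^sub>2\<close>. Put \<open>a\<^sub>1 = a\<close> and let each \<open>a\<^sub>i\<^sub>+\<^sub>1\<close> be the bracket \<open>[a\<^sub>i, a]\<close>.
  Then \<open>a\<^sub>2, \<dots>, a\<^sub>n\<^sub>-\<^sub>1\<close> lift \<open>e\<^sub>3, \<dots>, e\<^sub>n\<close>, while \<open>a\<^sub>n\<close> lies in \<open>K\<close>.

  The Leibniz identity fixes nearly all products. Right multiplication by \<open>a\<^sub>j\<close> is zero for \<open>j \<ge> 2\<close>
  (lemma \<open>brk_chain\<close>), and the products \<open>[a\<^sub>j, b]\<close> with \<open>j \<ge> 2\<close> vanish because \<open>[x, b]\<close> and \<open>[b, x]\<close> are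
  central for all \<open>x\<close> (lemma \<open>brk_chain_b\<close>). Only the four elements \<open>[b, a]\<close>, \<open>a\<^sub>n\<close>, \<open>[a, b]\<close> and
  \<open>[b, b]\<close> of \<open>K\<close> remain free; these correspond to the four dimensions of the second cohomology of
  \<open>F2 n\<close>. In this way \<open>a\<^sub>1, \<dots>, a\<^sub>n\<^sub>-\<^sub>1\<close>, \<open>b\<close> and the four elements satisfy the multiplication table of
  \<open>ext4_F2 n\<close> in every central extension (lemma \<open>brk_gen\<close>).

  Being non-split enters through one general principle, lemma \<open>nonsplit_kernel_subset_derived\<close>: the
  kernel of a non-split central extension is contained in the span of all brackets, since a central
  vector outside it could be split off as a direct summand. Brackets in \<open>E\<close> are combinations of
  \<open>a\<^sub>2, \<dots>, a\<^sub>n\<^sub>-\<^sub>1\<close> and the four free elements. The images of \<open>a\<^sub>2, \<dots>, a\<^sub>n\<^sub>-\<^sub>1\<close> under \<open>p\<close> are independent,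
  so \<open>K\<close> is spanned by the four free elements (lemma \<open>kernel_eq_span\<close>). As \<open>K\<close> has dimension 4, they form
  a basis of it, and the table describes \<open>E\<close> up to isomorphism (lemma \<open>iso_ext4\<close>).
\<close>

section \<open>Arithmetic in algebras carried by a subspace\<close>

lemma sum_fun_apply: "(\<Sum>i\<in>I. f i) x = (\<Sum>i\<in>I. f i x)"
  for f :: "'i \<Rightarrow> 'b \<Rightarrow> 'c::comm_monoid_add"
  by (induction I rule: infinite_finite_induct) auto

lemma fd_vector_space: "fd_algebra A \<Longrightarrow> vector_space (scl A)"
  and fd_subspace: "fd_algebra A \<Longrightarrow> module.subspace (scl A) (carr A)"
  and fd_brk: "fd_algebra A \<Longrightarrow> x \<in> carr A \<Longrightarrow> y \<in> carr A \<Longrightarrow> brk A x y \<in> carr A"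
  and brk_add_left: "fd_algebra A \<Longrightarrow> x \<in> carr A \<Longrightarrow> y \<in> carr A \<Longrightarrow> z \<in> carr A \<Longrightarrow>
        brk A (x + y) z = brk A x z + brk A y z"
  and brk_add_right: "fd_algebra A \<Longrightarrow> x \<in> carr A \<Longrightarrow> y \<in> carr A \<Longrightarrow> z \<in> carr A \<Longrightarrow>
        brk A x (y + z) = brk A x y + brk A x z"
  and brk_scl_left: "fd_algebra A \<Longrightarrow> x \<in> carr A \<Longrightarrow> y \<in> carr A \<Longrightarrow>
        brk A (scl A c x) y = scl A c (brk A x y)"
  and brk_scl_right: "fd_algebra A \<Longrightarrow> x \<in> carr A \<Longrightarrow> y \<in> carr A \<Longrightarrow>
        brk A x (scl A c y) = scl A c (brk A x y)"
  unfolding fd_algebra_def by blast+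

lemma
  assumes "fd_algebra A"
  shows fd_zero: "0 \<in> carr A"
    and fd_add: "x \<in> carr A \<Longrightarrow> y \<in> carr A \<Longrightarrow> x + y \<in> carr A"
    and fd_diff: "x \<in> carr A \<Longrightarrow> y \<in> carr A \<Longrightarrow> x - y \<in> carr A"
    and fd_scl: "x \<in> carr A \<Longrightarrow> scl A c x \<in> carr A"
    and fd_sum: "(\<And>i. i \<in> I \<Longrightarrow> h i \<in> carr A) \<Longrightarrow> (\<Sum>i\<in>I. h i) \<in> carr A"
proof -
  interpret vector_space "scl A" using assms by (rule fd_vector_space)
  note S = fd_subspace[OF assms]
  show "0 \<in> carr A" "x \<in> carr A \<Longrightarrow> y \<in> carr A \<Longrightarrow> x + y \<in> carr A"
    "x \<in> carr A \<Longrightarrow> y \<in> carr A \<Longrightarrow> x - y \<in> carr A"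
    "x \<in> carr A \<Longrightarrow> scl A c x \<in> carr A"
    "(\<And>i. i \<in> I \<Longrightarrow> h i \<in> carr A) \<Longrightarrow> (\<Sum>i\<in>I. h i) \<in> carr A"
    by (simp_all add: subspace_0[OF S] subspace_add[OF S] subspace_diff[OF S] subspace_scale[OF S]
      subspace_sum[OF S])
qed

lemma brk_zero_left: "fd_algebra A \<Longrightarrow> x \<in> carr A \<Longrightarrow> brk A 0 x = 0"
  using brk_add_left[of A 0 0 x] by (simp add: fd_zero)

lemma brk_zero_right: "fd_algebra A \<Longrightarrow> x \<in> carr A \<Longrightarrow> brk A x 0 = 0"
  using brk_add_right[of A x 0 0] by (simp add: fd_zero)

lemma brk_lincomb_left:
  assumes "fd_algebra A" "y \<in> carr A" "\<And>i. i \<in> I \<Longrightarrow> g i \<in> carr A"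
  shows "brk A (\<Sum>i\<in>I. scl A (c i) (g i)) y = (\<Sum>i\<in>I. scl A (c i) (brk A (g i) y))"
  using assms(3)
proof (induction I rule: infinite_finite_induct)
  case (insert i I)
  have "(\<Sum>i\<in>I. scl A (c i) (g i)) \<in> carr A"
    using insert by (intro fd_sum[OF assms(1)] fd_scl[OF assms(1)]) auto
  then show ?case
    using insert assms(1,2)
    by (simp add: brk_add_left brk_scl_left fd_scl)
qed (use assms(1,2) in \<open>auto simp: brk_zero_left\<close>)

lemma brk_lincomb_right:
  assumes "fd_algebra A" "y \<in> carr A" "\<And>i. i \<in> I \<Longrightarrow> g i \<in> carr A"
  shows "brk A y (\<Sum>i\<in>I. scl A (c i) (g i)) = (\<Sum>i\<in>I. scl A (c i) (brk A y (g i)))"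
  using assms(3)
proof (induction I rule: infinite_finite_induct)
  case (insert i I)
  have "(\<Sum>i\<in>I. scl A (c i) (g i)) \<in> carr A"
    using insert by (intro fd_sum[OF assms(1)] fd_scl[OF assms(1)]) auto
  then show ?case
    using insert assms(1,2)
    by (simp add: brk_add_right brk_scl_right fd_scl)
qed (use assms(1,2) in \<open>auto simp: brk_zero_right\<close>)

text \<open>
  Finite generation passes to subspaces because an independent subset of a finitely generated space
  is finite.
\<close>

lemma fd_algebra_subalgebra:
  assumes A: "fd_algebra A" and S: "module.subspace (scl A) S" "S \<subseteq> carr A"
    and closed: "\<And>x y. x \<in> S \<Longrightarrow> y \<in> S \<Longrightarrow> brk A x y \<in> S"
  shows "fd_algebra (A\<lparr>carr := S\<rparr>)"
proof -
  interpret vector_space "scl A" using A by (rule fd_vector_space)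
  obtain G where G: "finite G" "carr A = span G"
    using A unfolding fd_algebra_def by blast
  obtain B where B: "B \<subseteq> S" "independent B" "S \<subseteq> span B"
    by (rule maximal_independent_subset)
  have "finite B"
    using independent_span_bound[OF G(1) B(2)] B(1) S(2) G(2) by auto
  moreover have "S = span B"
    using B S(1) by (metis span_subspace)
  ultimately have "\<exists>B. finite B \<and> S = span B" by blast
  moreover have "x \<in> carr A" if "x \<in> S" for x using that S(2) by blast
  ultimately show ?thesis
    using A S closed unfolding fd_algebra_def by simp
qed

lemma leibniz_subalgebra:
  assumes "leibniz_algebra A" "module.subspace (scl A) S" "S \<subseteq> carr A"
    and "\<And>x y. x \<in> S \<Longrightarrow> y \<in> S \<Longrightarrow> brk A x y \<in> S"
  shows "leibniz_algebra (A\<lparr>carr := S\<rparr>)"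
  using assms fd_algebra_subalgebra[of A S] unfolding leibniz_algebra_def
  by (simp add: subset_iff)

section \<open>Homomorphisms and subspaces\<close>

lemma
  assumes "alg_hom A B f"
  shows hom_carr: "x \<in> carr A \<Longrightarrow> f x \<in> carr B"
    and hom_add: "x \<in> carr A \<Longrightarrow> y \<in> carr A \<Longrightarrow> f (x + y) = f x + f y"
    and hom_scl: "x \<in> carr A \<Longrightarrow> f (scl A c x) = scl B c (f x)"
    and hom_brk: "x \<in> carr A \<Longrightarrow> y \<in> carr A \<Longrightarrow> f (brk A x y) = brk B (f x) (f y)"
  using assms unfolding alg_hom_def by blast+

lemma hom_zero:
  assumes "fd_algebra A" "alg_hom A B f"
  shows "f 0 = 0"
  using hom_add[OF assms(2), of 0 0] fd_zero[OF assms(1)] by simp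

lemma hom_diff:
  assumes A: "fd_algebra A" "alg_hom A B f" and xy: "x \<in> carr A" "y \<in> carr A"
  shows "f (x - y) = f x - f y"
  using hom_add[OF A(2) fd_diff[OF A(1) xy] xy(2)] by (simp add: eq_diff_eq)

lemma hom_lincomb:
  assumes A: "fd_algebra A" "alg_hom A B f" and g: "\<And>i. i \<in> I \<Longrightarrow> g i \<in> carr A"
  shows "f (\<Sum>i\<in>I. scl A (c i) (g i)) = (\<Sum>i\<in>I. scl B (c i) (f (g i)))"
  using g
proof (induction I rule: infinite_finite_induct)
  case (insert i I)
  have "(\<Sum>i\<in>I. scl A (c i) (g i)) \<in> carr A"
    using insert by (intro fd_sum[OF A(1)] fd_scl[OF A(1)]) auto
  then show ?case
    using insert A by (simp add: hom_add[OF A(2)] hom_scl[OF A(2)] fd_scl)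
qed (use hom_zero[OF A] in auto)

lemma kernel_subspace:
  assumes "fd_algebra A" "fd_algebra B" "alg_hom A B f"
  shows "module.subspace (scl A) {x \<in> carr A. f x = 0}"
proof -
  interpret A: vector_space "scl A" using assms(1) by (rule fd_vector_space)
  interpret B: vector_space "scl B" using assms(2) by (rule fd_vector_space)
  show ?thesis
    by (intro A.subspaceI)
      (auto simp: fd_zero[OF assms(1)] fd_add[OF assms(1)] fd_scl[OF assms(1)]
        hom_zero[OF assms(1,3)] hom_add[OF assms(3)] hom_scl[OF assms(3)])
qed

text \<open>
  A homomorphism is linear on the carrier only. Extending its restriction to a basis of \<open>S\<close> gives a
  map that is linear on the whole ambient space and agrees with it on \<open>S\<close>; that map carries the basis to
  a basis of the image.
\<close>

lemma hom_dim_image: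
  assumes A: "fd_algebra A" and B: "vector_space (scl B)" and f: "alg_hom A B f"
    and S: "module.subspace (scl A) S" "S \<subseteq> carr A" "inj_on f S"
  shows "vector_space.dim (scl B) (f ` S) = vector_space.dim (scl A) S"
proof -
  interpret A: vector_space "scl A" using A by (rule fd_vector_space)
  interpret B: vector_space "scl B" by (rule B)
  interpret P: vector_space_pair "scl A" "scl B" ..
  obtain X where X: "X \<subseteq> S" "A.independent X" "S \<subseteq> A.span X" "card X = A.dim S"
    by (rule A.basis_exists)
  have spX: "A.span X = S" using X S(1) by (metis A.span_subspace)
  obtain g where g: "Vector_Spaces.linear (scl A) (scl B) g" "\<forall>x\<in>X. g x = f x"
    using P.linear_independent_extend[OF X(2)] by blast
  have gadd: "g (x + y) = g x + g y" and gscl: "g (scl A c x) = scl B c (g x)" for x y c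
    using g(1) unfolding Vector_Spaces.linear_iff by auto
  have "A.subspace {x \<in> carr A. g x = f x}"
    using fd_zero[OF A] fd_add[OF A] fd_scl[OF A] gadd[of 0 0] hom_zero[OF A f]
    by (intro A.subspaceI) (auto simp: gadd gscl hom_add[OF f] hom_scl[OF f])
  then have "A.span X \<subseteq> {x \<in> carr A. g x = f x}"
    using X(1) S(2) g(2) by (intro A.span_minimal) auto
  then have eq: "g x = f x" if "x \<in> S" for x using that spX by auto
  have inj: "inj_on g (A.span X)"
    using S(3) eq by (auto simp: inj_on_def spX)
  have ind: "B.independent (g ` X)"
    using P.linear_independent_injective_image[OF g(1) X(2) inj] .
  have "B.span (g ` X) = g ` A.span X"
    using g(1) by (rule P.linear_span_image)
  also have "\<dots> = f ` S" using eq spX by auto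
  finally have "B.dim (f ` S) = card (g ` X)"
    using ind by (metis B.dim_span_eq_card_independent)
  also have "\<dots> = card X"
    using inj A.span_superset by (intro card_image) (blast intro: inj_on_subset)
  finally show ?thesis using X(4) by simp
qed

lemma inv_into_hom:
  assumes A: "fd_algebra A" and f: "alg_hom A B f" and bij: "bij_betw f (carr A) (carr B)"
  shows "alg_hom B A (inv_into (carr A) f)"
proof -
  let ?h = "inv_into (carr A) f"
  have h: "?h y \<in> carr A" "f (?h y) = y" if "y \<in> carr B" for y
    using that bij by (auto simp: bij_betw_def inv_into_into f_inv_into_f)
  have hf: "?h (f x) = x" if "x \<in> carr A" for x
    using that bij by (auto simp: bij_betw_def)
  show ?thesis
    unfolding alg_hom_def
  proof (intro conjI ballI allI)
    fix x y c assume x: "x \<in> carr B" and y: "y \<in> carr B"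
    show "?h (x + y) = ?h x + ?h y"
      using hf[of "?h x + ?h y"] h[OF x] h[OF y] hom_add[OF f] fd_add[OF A] by simp
    show "?h (brk B x y) = brk A (?h x) (?h y)"
      using hf[of "brk A (?h x) (?h y)"] h[OF x] h[OF y] hom_brk[OF f] fd_brk[OF A] by simp
  next
    fix x c assume x: "x \<in> carr B"
    show "?h (scl B c x) = scl A c (?h x)"
      using hf[of "scl A c (?h x)"] h[OF x] hom_scl[OF f] fd_scl[OF A] by simp
  qed (use h in auto)
qed

section \<open>Central extensions described by their projection\<close>

text \<open>
  The abstract central algebra of an extension can be replaced by the kernel of the projection, which
  has the same dimension. Together with the converse below, this lets the remaining arguments work with
  the projection alone.
\<close>

lemma central_extensionE:
  fixes E :: "('a::ab_group_add) calg"
  assumes "central_extension k E L"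
  obtains p where "leibniz_algebra E" "leibniz_algebra L" "alg_hom E L p"
    "p ` carr E = carr L" "{x \<in> carr E. p x = 0} \<subseteq> alg_center E"
    "vector_space.dim (scl E) {x \<in> carr E. p x = 0} = k"
proof -
  obtain V :: "'a calg" and i p where ex: "short_exact V i E p L"
    and d: "alg_dim V = k" and c: "i ` carr V \<subseteq> alg_center E"
    using assms unfolding central_extension_def by blast
  then have V: "fd_algebra V" and E: "fd_algebra E" and i: "alg_hom V E i" "inj_on i (carr V)"
    and im: "i ` carr V = {x \<in> carr E. p x = 0}"
    unfolding short_exact_def leibniz_algebra_def by auto
  have "vector_space.dim (scl E) (i ` carr V) = k"
    using hom_dim_image[OF V fd_vector_space[OF E] i(1) fd_subspace[OF V] _ i(2)] d
    by (simp add: alg_dim_def)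
  then show thesis
    using ex c im that[of p] unfolding short_exact_def by auto
qed

lemma central_extensionI:
  assumes E: "leibniz_algebra E" and L: "leibniz_algebra L" and p: "alg_hom E L p"
    "p ` carr E = carr L" and c: "{x \<in> carr E. p x = 0} \<subseteq> alg_center E"
    and d: "vector_space.dim (scl E) {x \<in> carr E. p x = 0} = k"
  shows "central_extension k E L"
proof -
  let ?K = "{x \<in> carr E. p x = 0}"
  let ?V = "E\<lparr>carr := ?K\<rparr>"
  have fd: "fd_algebra E" "fd_algebra L" using E L by (auto simp: leibniz_algebra_def)
  have S: "module.subspace (scl E) ?K" by (rule kernel_subspace[OF fd p(1)])
  have "p 0 = 0" using hom_zero[OF fd(1) p(1)] .
  then have br: "brk E x y \<in> ?K" if "x \<in> ?K" "y \<in> ?K" for x y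
    using c that fd_zero[OF fd(1)] unfolding alg_center_def by auto
  have V: "leibniz_algebra ?V"
    using E S br by (intro leibniz_subalgebra) auto
  have "short_exact ?V (\<lambda>x. x) E p L"
    unfolding short_exact_def using V E L p by (auto simp: alg_hom_def inj_on_def)
  then show ?thesis
    unfolding central_extension_def
    by (intro exI[of _ ?V] exI[of _ "\<lambda>x. x"] exI[of _ p]) (use c d in \<open>auto simp: alg_dim_def\<close>)
qed

lemma leibniz_iso:
  assumes A: "leibniz_algebra A" and B: "fd_algebra B"
    and f: "alg_hom A B f" and sur: "f ` carr A = carr B"
  shows "leibniz_algebra B"
proof -
  have fA: "fd_algebra A" using A by (simp add: leibniz_algebra_def)
  show ?thesis
    unfolding leibniz_algebra_def
  proof (intro conjI B ballI)
    fix x y z assume "x \<in> carr B" "y \<in> carr B" "z \<in> carr B"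
    then obtain u v w where "u \<in> carr A" "v \<in> carr A" "w \<in> carr A" "x = f u" "y = f v" "z = f w"
      using sur by blast
    moreover have "brk A u (brk A v w) = brk A (brk A u v) w - brk A (brk A u w) v"
      using A calculation unfolding leibniz_algebra_def by blast
    ultimately show "brk B x (brk B y z) = brk B (brk B x y) z - brk B (brk B x z) y"
      using fd_brk[OF fA] hom_brk[OF f] hom_diff[OF fA f] by metis
  qed
qed

text \<open>
  The projection is composed with the inverse isomorphism, so its kernel is the image of the old one.
\<close>

lemma central_extension_iso:
  assumes ext: "central_extension k A L" and B: "fd_algebra B"
    and f: "alg_hom A B f" "bij_betw f (carr A) (carr B)"
  shows "central_extension k B L"
proof -
  obtain p where A: "leibniz_algebra A" and L: "leibniz_algebra L" and p: "alg_hom A L p"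
    "p ` carr A = carr L" "{x \<in> carr A. p x = 0} \<subseteq> alg_center A"
    "vector_space.dim (scl A) {x \<in> carr A. p x = 0} = k"
    by (rule central_extensionE[OF ext])
  let ?h = "inv_into (carr A) f"
  let ?K = "{x \<in> carr A. p x = 0}"
  have fA: "fd_algebra A" and fL: "fd_algebra L" using A L by (auto simp: leibniz_algebra_def)
  have sur: "f ` carr A = carr B" and inj: "inj_on f (carr A)" using f(2) by (auto simp: bij_betw_def)
  have h: "alg_hom B A ?h" using inv_into_hom[OF fA f] .
  have hf: "?h (f x) = x" if "x \<in> carr A" for x
    using that inj by simp
  have K: "{y \<in> carr B. p (?h y) = 0} = f ` ?K"
    using hf hom_carr[OF f(1)] by (auto simp: sur[symmetric])
  show ?thesis
  proof (rule central_extensionI)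
    show "leibniz_algebra B" by (rule leibniz_iso[OF A B f(1) sur])
    show "leibniz_algebra L" by (rule L)
    show "alg_hom B L (\<lambda>y. p (?h y))"
      using h p(1) unfolding alg_hom_def by auto
    show "(\<lambda>y. p (?h y)) ` carr B = carr L"
      using p(2) inj by (simp add: sur[symmetric] image_image cong: image_cong_simp)
    show "{y \<in> carr B. p (?h y) = 0} \<subseteq> alg_center B"
      unfolding K using p(3) hom_brk[OF f(1)] hom_carr[OF f(1)] hom_zero[OF fA f(1)]
      unfolding alg_center_def sur[symmetric] by (auto simp flip: hom_brk[OF f(1)])
    show "vector_space.dim (scl B) {y \<in> carr B. p (?h y) = 0} = k"
      unfolding K
      using hom_dim_image[OF fA fd_vector_space[OF B] f(1) kernel_subspace[OF fA fL p(1)] _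
          inj_on_subset[OF inj]] p(4) by auto
  qed
qed

section \<open>Coordinates\<close>

definition fun_scale :: "complex \<Rightarrow> (nat \<Rightarrow> complex) \<Rightarrow> nat \<Rightarrow> complex" where
  "fun_scale c x = (\<lambda>i. c * x i)"

lemma vector_space_fun: "vector_space fun_scale"
  by unfold_locales (auto simp: fun_scale_def fun_eq_iff algebra_simps)

lemma inj_basis_e: "inj basis_e"
  by (auto simp: inj_def basis_e_def fun_eq_iff split: if_splits)

lemma independent_basis_e:
  "\<not> module.dependent fun_scale (basis_e ` I)"
proof -
  interpret vector_space fun_scale by (rule vector_space_fun)
  have inj: "inj basis_e" by (auto simp: inj_def basis_e_def fun_eq_iff split: if_splits)
  show ?thesis
  proof
    assume "dependent (basis_e ` I)"
    then obtain i where i: "basis_e i \<in> span (basis_e ` I - {basis_e i})"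
      unfolding dependent_def by auto
    have "subspace {x. x i = 0}" unfolding subspace_def by (simp add: fun_scale_def)
    moreover have "basis_e ` I - {basis_e i} \<subseteq> {x. x i = 0}" by (auto simp: basis_e_def)
    ultimately have "span (basis_e ` I - {basis_e i}) \<subseteq> {x. x i = 0}"
      by (rule span_minimal[rotated])
    then have "basis_e i i = 0" using i by blast
    then show False by (simp add: basis_e_def)
  qed
qed

text \<open>
  A basis of the carrier is numbered and mapped to the corresponding unit vectors; the bracket is then
  transported along this injection. Splitting asks for the smaller extension on the coordinate type,
  and this lemma moves it there.
\<close>

lemma coordinate_copy:
  assumes A: "fd_algebra A"
  obtains B :: "(nat \<Rightarrow> complex) calg" and f
  where "fd_algebra B" "alg_hom A B f" "bij_betw f (carr A) (carr B)"
proof -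
  interpret A: vector_space "scl A" using A by (rule fd_vector_space)
  interpret N: vector_space fun_scale by (rule vector_space_fun)
  interpret P: vector_space_pair "scl A" fun_scale ..
  obtain G where G: "finite G" "carr A = A.span G"
    using A unfolding fd_algebra_def by blast
  obtain X where X: "X \<subseteq> carr A" "A.independent X" "carr A \<subseteq> A.span X"
    by (rule A.maximal_independent_subset)
  have finX: "finite X" using A.independent_span_bound[OF G(1) X(2)] X(1) G(2) by auto
  have spX: "A.span X = carr A" using X fd_subspace[OF A] by (metis A.span_subspace)
  obtain h :: "'a \<Rightarrow> nat" where h: "inj_on h X"
    using finite_imp_inj_to_nat_seg[OF finX] by auto
  obtain f where f: "Vector_Spaces.linear (scl A) fun_scale f" "\<forall>x\<in>X. f x = basis_e (h x)"
    using P.linear_independent_extend[OF X(2), of "\<lambda>x. basis_e (h x)"] by blast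
  have fadd: "f (x + y) = f x + f y" and fscl: "f (scl A c x) = fun_scale c (f x)" for x y c
    using f(1) unfolding Vector_Spaces.linear_iff by auto
  have fX: "f ` X = basis_e ` (h ` X)" using f(2) by force
  have "inj_on f X" using f(2) h inj_basis_e by (auto simp: inj_on_def inj_def)
  then have "inj_on f (A.span X)"
    using independent_basis_e[of "h ` X"] fX
    by (intro P.linear_inj_on_span_independent_image[OF f(1)]) auto
  then have inj: "inj_on f (carr A)" by (simp add: spX)
  let ?h = "inv_into (carr A) f"
  have hf: "?h (f x) = x" if "x \<in> carr A" for x using that inj by simp
  define B where "B = \<lparr>carr = f ` carr A, scl = fun_scale,
     brk = (\<lambda>u v. f (brk A (?h u) (?h v)))\<rparr>"
  have hom: "alg_hom A B f"
    unfolding alg_hom_def B_def using hf by (simp add: fadd fscl)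
  have "fd_algebra B"
    unfolding fd_algebra_def
  proof (intro conjI ballI allI)
    show "vector_space (scl B)" unfolding B_def by (simp add: vector_space_fun)
    have im: "N.span (f ` X) = f ` carr A"
      using P.linear_span_image[OF f(1)] spX by simp
    then show "module.subspace (scl B) (carr B)"
      unfolding B_def by (simp flip: im)
    show "\<exists>B'. finite B' \<and> carr B = module.span (scl B) B'"
      using im finX unfolding B_def by (intro exI[of _ "f ` X"]) auto
  next
    fix x y assume "x \<in> carr B" "y \<in> carr B"
    then obtain u v where u: "u \<in> carr A" "v \<in> carr A" "x = f u" "y = f v"
      unfolding B_def by auto
    then show "brk B x y \<in> carr B" unfolding B_def by (simp add: hf fd_brk[OF A])
    fix c
    have "scl B c x = f (scl A c u)" "scl B c y = f (scl A c v)"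
      using u by (simp_all add: B_def fscl)
    then show "brk B (scl B c x) y = scl B c (brk B x y)"
      "brk B x (scl B c y) = scl B c (brk B x y)"
      using u hom_brk[OF hom] fd_scl[OF A] fd_brk[OF A] brk_scl_left[OF A]
          brk_scl_right[OF A] hom_scl[OF hom] by metis+
  next
    fix x y z assume "x \<in> carr B" "y \<in> carr B" "z \<in> carr B"
    then obtain u v w where u: "u \<in> carr A" "v \<in> carr A" "w \<in> carr A"
      "x = f u" "y = f v" "z = f w"
      unfolding B_def by auto
    then show "brk B (x + y) z = brk B x z + brk B y z" "brk B x (y + z) = brk B x y + brk B x z"
      using fd_add[OF A]
      by (simp_all add: B_def hf fd_brk[OF A] brk_add_left[OF A] brk_add_right[OF A]
          flip: fadd)
  qed
  moreover have "bij_betw f (carr A) (carr B)"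
    using inj by (simp add: bij_betw_def B_def)
  ultimately show thesis using hom that by blast
qed

section \<open>Non-split extensions\<close>

text \<open>
  A central direction \<open>z\<close> that is not produced by brackets can be split off. If \<open>z\<close> lies outside \<open>D\<close>, some
  linear functional \<open>g\<close> vanishes on \<open>D\<close> and has \<open>g z = 1\<close>. Its kernel \<open>S\<close> in \<open>E\<close> contains all brackets, so
  it is a subalgebra, and centrality of \<open>z\<close> makes \<open>E\<close> the direct sum of \<open>S\<close> and the line through \<open>z\<close>.
  The projection still maps \<open>S\<close> onto \<open>L\<close>, and its kernel has lost exactly one dimension.
\<close>

lemma nonsplit_kernel_subset_derived:
  assumes ns: "nonsplit_extension (Suc k) E L"
    and p: "alg_hom E L p" "p ` carr E = carr L"
    and c: "{x \<in> carr E. p x = 0} \<subseteq> alg_center E"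
    and d: "vector_space.dim (scl E) {x \<in> carr E. p x = 0} = Suc k"
    and D: "module.subspace (scl E) D"
    and brD: "\<And>x y. x \<in> carr E \<Longrightarrow> y \<in> carr E \<Longrightarrow> brk E x y \<in> D"
  shows "{x \<in> carr E. p x = 0} \<subseteq> D"
proof (rule ccontr)
  let ?K = "{x \<in> carr E. p x = 0}"
  assume "\<not> ?K \<subseteq> D"
  then obtain z where z: "z \<in> carr E" "p z = 0" "z \<notin> D" by blast
  have ext: "central_extension (Suc k) E L" and nsp: "\<not> split_extension (Suc k) E L"
    using ns by (auto simp: nonsplit_extension_def)
  have EL: "leibniz_algebra E" "leibniz_algebra L"
    using central_extensionE[OF ext] by blast+
  then have E: "fd_algebra E" and L: "fd_algebra L" by (auto simp: leibniz_algebra_def)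
  interpret E: vector_space "scl E" using E by (rule fd_vector_space)
  interpret C: vector_space "(*) :: complex \<Rightarrow> complex \<Rightarrow> complex"
    by unfold_locales (auto simp: algebra_simps)
  interpret P: vector_space_pair "scl E" "(*) :: complex \<Rightarrow> complex \<Rightarrow> complex" ..
  interpret Lv: vector_space "scl L" using L by (rule fd_vector_space)
  obtain X where X: "X \<subseteq> D" "E.independent X" "D \<subseteq> E.span X"
    by (rule E.maximal_independent_subset)
  have spX: "E.span X = D" using X D by (metis E.span_subspace)
  have "E.independent (insert z X)" using X(2) z(3) spX by (intro E.independent_insertI) auto
  then obtain g where g: "Vector_Spaces.linear (scl E) (*) g" "\<forall>x\<in>insert z X. g x = (if x = z then 1 else 0)"
    using P.linear_independent_extend[of _ "\<lambda>x. if x = z then 1 else 0"] by blast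
  have gadd: "g (x + y) = g x + g y" and gscl: "g (scl E c x) = c * g x" for x y c
    using g(1) unfolding Vector_Spaces.linear_iff by auto
  have g0: "g 0 = 0" using gadd[of 0 0] by simp
  have gdiff: "g (x - y) = g x - g y" for x y using gadd[of "x - y" y] by simp
  have gz: "g z = 1" using g(2) by simp
  have "E.subspace {x. g x = 0}" by (intro E.subspaceI) (auto simp: g0 gadd gscl)
  then have "E.span X \<subseteq> {x. g x = 0}"
    using g(2) X(1) z(3) by (intro E.span_minimal) auto
  then have gD: "g x = 0" if "x \<in> D" for x using that spX by auto
  define S where "S = {x \<in> carr E. g x = 0}"
  have subS: "E.subspace S"
    unfolding S_def by (intro E.subspaceI) (auto simp: g0 gadd gscl fd_zero[OF E] fd_add[OF E] fd_scl[OF E])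
  have SE: "S \<subseteq> carr E" by (auto simp: S_def)
  have brS: "brk E x y \<in> S" if "x \<in> carr E" "y \<in> carr E" for x y
    using that brD gD fd_brk[OF E] by (auto simp: S_def)
  define E' where "E' = E\<lparr>carr := S\<rparr>"
  have E': "leibniz_algebra E'" unfolding E'_def
    using EL(1) subS SE brS by (intro leibniz_subalgebra) auto
  \<comment> \<open>The projection of \<open>E\<close> onto \<open>S\<close> along \<open>z\<close>; it does not change the image in \<open>L\<close>.\<close>
  define \<pi> where "\<pi> x = x - scl E (g x) z" for x
  have \<pi>S: "\<pi> x \<in> S" if "x \<in> carr E" for x
    using that z(1) by (auto simp: \<pi>_def S_def gdiff gscl gz fd_diff[OF E] fd_scl[OF E])
  have p\<pi>: "p (\<pi> x) = p x" if "x \<in> carr E" for x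
    using that z(1,2)
    by (simp add: \<pi>_def hom_diff[OF E p(1)] hom_scl[OF p(1)] fd_scl[OF E])
  have ker: "{x \<in> carr E'. p x = 0} = ?K \<inter> S" by (auto simp: E'_def S_def)
  have subKS: "E.subspace (?K \<inter> S)"
    by (intro E.subspace_inter kernel_subspace[OF E L p(1)] subS)
  have "E.dim (?K \<inter> S) = k"
  proof -
    obtain Y where Y: "Y \<subseteq> ?K \<inter> S" "E.independent Y" "?K \<inter> S \<subseteq> E.span Y"
      "card Y = E.dim (?K \<inter> S)"
      by (rule E.basis_exists)
    have spY: "E.span Y = ?K \<inter> S" using Y subKS by (metis E.span_subspace)
    have "z \<notin> S" using gz by (simp add: S_def)
    then have ind: "E.independent (insert z Y)" and zY: "z \<notin> Y"
      using Y(1,2) spY E.independent_insertI[of z Y] by auto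
    have "?K \<subseteq> E.span (insert z Y)"
    proof
      fix x assume "x \<in> ?K"
      then have "\<pi> x \<in> E.span Y" using \<pi>S p\<pi> SE spY by auto
      then show "x \<in> E.span (insert z Y)"
        unfolding \<pi>_def E.span_breakdown_eq by blast
    qed
    moreover have "insert z Y \<subseteq> ?K" using z Y(1) by auto
    ultimately have "card (insert z Y) = Suc k"
      using E.basis_card_eq_dim[of "insert z Y" ?K] ind d by simp
    moreover obtain G where G: "finite G" "carr E = E.span G"
      using E unfolding fd_algebra_def by blast
    moreover have "finite Y"
      using E.independent_span_bound[OF G(1) Y(2)] Y(1) G(2) by auto
    ultimately show ?thesis using zY Y(4) by simp
  qed
  then have extE': "central_extension k E' L"
  proof (intro central_extensionI[of E' L p] E' EL)
    show "alg_hom E' L p" using p(1) SE unfolding alg_hom_def E'_def by (simp add: subset_iff)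
    have "carr L \<subseteq> p ` S"
    proof
      fix y assume "y \<in> carr L"
      then obtain x where "x \<in> carr E" "y = p x" using p(2) by blast
      then show "y \<in> p ` S" using p\<pi> \<pi>S by (intro image_eqI[of _ _ "\<pi> x"]) simp_all
    qed
    then show "p ` carr E' = carr L" using p(2) SE by (auto simp: E'_def)
    show "{x \<in> carr E'. p x = 0} \<subseteq> alg_center E'"
      using c SE unfolding ker by (auto simp: alg_center_def E'_def)
    assume "E.dim (?K \<inter> S) = k"
    then show "vector_space.dim (scl E') {x \<in> carr E'. p x = 0} = k"
      unfolding ker by (simp add: E'_def)
  qed
  obtain B :: "(nat \<Rightarrow> complex) calg" and f
    where B: "fd_algebra B" and f: "alg_hom E' B f" "bij_betw f (carr E') (carr B)"
    using coordinate_copy[of E'] E' by (auto simp: leibniz_algebra_def)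
  have extB: "central_extension k B L"
    by (rule central_extension_iso[OF extE' B f])
  have zc: "brk E x z = 0" "brk E z x = 0" if "x \<in> carr E" for x
    using that z c by (auto simp: alg_center_def)
  \<comment> \<open>The direct sum decomposition, with \<open>f\<close> moving the summand \<open>S\<close> to the coordinate type.\<close>
  let ?F = "\<lambda>x. (f (\<pi> x), g x)"
  have carrE': "carr E' = S" "scl E' = scl E" "brk E' = brk E" by (auto simp: E'_def)
  have \<pi>E: "\<pi> x \<in> carr E" if "x \<in> carr E" for x using \<pi>S that SE by blast
  have br\<pi>: "brk E (\<pi> x) (\<pi> y) = brk E x y" if "x \<in> carr E" "y \<in> carr E" for x y
  proof -
    have sz: "scl E c z \<in> carr E" for c using z(1) fd_scl[OF E] by blast
    have "brk E x y = brk E (\<pi> x + scl E (g x) z) (\<pi> y + scl E (g y) z)"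
      by (simp add: \<pi>_def)
    also have "\<dots> = brk E (\<pi> x) (\<pi> y)"
      using \<pi>E[OF that(1)] \<pi>E[OF that(2)] sz z(1) zc
      by (simp add: brk_add_left[OF E] brk_add_right[OF E] fd_add[OF E] brk_scl_left[OF E]
          brk_scl_right[OF E])
    finally show ?thesis by simp
  qed
  have "alg_hom E (B \<oplus>\<^sub>a abelian_C) ?F"
    unfolding alg_hom_def
  proof (intro conjI ballI allI)
    fix x assume x: "x \<in> carr E"
    show "?F x \<in> carr (B \<oplus>\<^sub>a abelian_C)"
      using hom_carr[OF f(1)] \<pi>S[OF x] carrE' by (simp add: direct_sum_def abelian_C_def)
    show "?F (scl E c x) = scl (B \<oplus>\<^sub>a abelian_C) c (?F x)" for c
    proof -
      have "\<pi> (scl E c x) = scl E c (\<pi> x)"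
        by (simp add: \<pi>_def gscl E.scale_right_diff_distrib)
      then show ?thesis
        using hom_scl[OF f(1)] \<pi>S[OF x] carrE' by (simp add: direct_sum_def abelian_C_def gscl)
    qed
    fix y assume y: "y \<in> carr E"
    have "\<pi> (x + y) = \<pi> x + \<pi> y"
      by (simp add: \<pi>_def gadd E.scale_left_distrib)
    then show "?F (x + y) = ?F x + ?F y"
      using hom_add[OF f(1)] \<pi>S x y carrE' by (simp add: gadd)
    have "g (brk E x y) = 0" using brS x y by (auto simp: S_def)
    moreover have "\<pi> (brk E x y) = brk E (\<pi> x) (\<pi> y)"
      using br\<pi>[OF x y] calculation by (simp add: \<pi>_def)
    ultimately show "?F (brk E x y) = brk (B \<oplus>\<^sub>a abelian_C) (?F x) (?F y)"
      using hom_brk[OF f(1)] \<pi>S x y carrE' by (simp add: direct_sum_def abelian_C_def)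
  qed
  moreover have "bij_betw ?F (carr E) (carr (B \<oplus>\<^sub>a abelian_C))"
    unfolding bij_betw_def
  proof
    have inj: "inj_on f S" and sur: "f ` S = carr B" using f(2) carrE' by (auto simp: bij_betw_def)
    show "inj_on ?F (carr E)"
    proof (rule inj_onI)
      fix x y assume xy: "x \<in> carr E" "y \<in> carr E" "?F x = ?F y"
      then have "\<pi> x = \<pi> y" using inj \<pi>S by (auto simp: inj_on_def)
      then show "x = y" using xy by (simp add: \<pi>_def)
    qed
    show "?F ` carr E = carr (B \<oplus>\<^sub>a abelian_C)"
    proof (intro subset_antisym subsetI)
      fix w assume "w \<in> ?F ` carr E"
      then show "w \<in> carr (B \<oplus>\<^sub>a abelian_C)"
        using \<pi>S sur by (auto simp: direct_sum_def abelian_C_def)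
    next
      fix w assume "w \<in> carr (B \<oplus>\<^sub>a abelian_C)"
      then have "fst w \<in> f ` S"
        unfolding sur by (auto simp: direct_sum_def)
      then obtain u r where w: "w = (f u, r)" "u \<in> S"
        by (metis imageE prod.collapse)
      let ?x = "u + scl E r z"
      have "g ?x = r" using w by (simp add: gadd gscl gz S_def)
      then have "?F ?x = w" using w by (simp add: \<pi>_def)
      moreover have "?x \<in> carr E" using w SE z(1) fd_add[OF E] fd_scl[OF E] by auto
      ultimately show "w \<in> ?F ` carr E" by (intro image_eqI[of _ _ ?x]) simp_all
    qed
  qed
  ultimately have "E \<cong>\<^sub>a B \<oplus>\<^sub>a abelian_C" unfolding alg_iso_def by blast
  then have "split_extension (Suc k) E L"
    using ext extB unfolding split_extension_def by blast
  then show False using nsp by blast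
qed

section \<open>Indexed families\<close>

lemma span_family:
  assumes "vector_space s" "finite I" "x \<in> module.span s (g ` I)"
  obtains c where "x = (\<Sum>i\<in>I. s (c i) (g i))"
proof -
  interpret vector_space s by (rule assms(1))
  let ?T = "{\<Sum>i\<in>I. s (c i) (g i) |c. True}"
  have "subspace ?T"
  proof (rule subspaceI)
    show "0 \<in> ?T" by (auto intro!: exI[of _ "\<lambda>_. 0"])
  next
    fix x y assume "x \<in> ?T" "y \<in> ?T"
    then obtain c c' where "x = (\<Sum>i\<in>I. s (c i) (g i))" "y = (\<Sum>i\<in>I. s (c' i) (g i))" by blast
    then have "x + y = (\<Sum>i\<in>I. s (c i + c' i) (g i))"
      by (simp add: scale_left_distrib sum.distrib)
    then show "x + y \<in> ?T" by (intro CollectI exI[of _ "\<lambda>i. c i + c' i"] conjI TrueI)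
  next
    fix a x assume "x \<in> ?T"
    then obtain c where "x = (\<Sum>i\<in>I. s (c i) (g i))" by blast
    then have "s a x = (\<Sum>i\<in>I. s (a * c i) (g i))" by (simp add: scale_sum_right)
    then show "s a x \<in> ?T" by (intro CollectI exI[of _ "\<lambda>i. a * c i"] conjI TrueI)
  qed
  moreover have "g ` I \<subseteq> ?T"
  proof
    fix y assume "y \<in> g ` I"
    then obtain j where j: "j \<in> I" "y = g j" by blast
    have "(\<Sum>i\<in>I. s (if i = j then 1 else 0) (g i)) = (\<Sum>i\<in>I. if i = j then g i else 0)"
      by (intro sum.cong) auto
    then have "y = (\<Sum>i\<in>I. s (if i = j then 1 else 0) (g i))"
      using assms(2) j by simp
    then show "y \<in> ?T"
      by (intro CollectI exI[of _ "\<lambda>i. if i = j then 1 else 0"] conjI TrueI)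
  qed
  ultimately have "span (g ` I) \<subseteq> ?T" by (intro span_minimal)
  then show thesis using assms(3) that by blast
qed

text \<open>
  A nontrivial relation would make one member redundant, and the span would then be generated by fewer
  elements than its dimension. Counting indices instead of members also rules out repetitions.
\<close>

lemma family_independent:
  assumes "vector_space s" "finite I" "vector_space.dim s (g ` I) = card I"
    and zero: "(\<Sum>i\<in>I. s (c i) (g i)) = 0" and j: "j \<in> I"
  shows "c j = 0"
proof (rule ccontr)
  interpret vector_space s by (rule assms(1))
  assume cj: "c j \<noteq> 0"
  let ?S = "g ` (I - {j})"
  have "(\<Sum>i\<in>I. s (c i) (g i)) = s (c j) (g j) + (\<Sum>i\<in>I - {j}. s (c i) (g i))"
    using assms(2) j by (rule sum.remove)
  then have "s (c j) (g j) = - (\<Sum>i\<in>I - {j}. s (c i) (g i))"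
    using zero by (simp add: eq_neg_iff_add_eq_0)
  moreover have "- (\<Sum>i\<in>I - {j}. s (c i) (g i)) \<in> span ?S"
    by (intro span_neg span_sum span_scale span_base) auto
  ultimately have "s (inverse (c j)) (s (c j) (g j)) \<in> span ?S"
    using span_scale by metis
  then have "g j \<in> span ?S" using cj by simp
  then have "g ` I \<subseteq> span ?S" using span_superset[of ?S] by blast
  then have "dim (g ` I) \<le> card ?S" using assms(2) by (intro dim_le_card) auto
  also have "\<dots> \<le> card (I - {j})" using assms(2) by (intro card_image_le) auto
  finally show False using assms(2,3) j
    by (metis card_Diff1_less not_less)
qed

section \<open>Algebras given by a multiplication table\<close>

lemma carr_table: "carr (table_algebra d t) = {x. \<forall>i. i \<notin> {1..d} \<longrightarrow> x i = 0}"
  and scl_table: "scl (table_algebra d t) = fun_scale"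
  and brk_table: "brk (table_algebra d t) x y k = (\<Sum>i=1..d. \<Sum>j=1..d. x i * y j * t i j k)"
  by (simp_all add: table_algebra_def fun_scale_def fun_eq_iff)

lemma basis_expansion:
  assumes "finite I" "\<And>i. i \<notin> I \<Longrightarrow> x i = 0"
  shows "x = (\<Sum>i\<in>I. fun_scale (x i) (basis_e i))"
proof
  fix k
  have "(\<Sum>i\<in>I. fun_scale (x i) (basis_e i)) k = (\<Sum>i\<in>I. if k = i then x i else 0)"
    unfolding sum_fun_apply by (intro sum.cong) (auto simp: fun_scale_def basis_e_def)
  then show "x k = (\<Sum>i\<in>I. fun_scale (x i) (basis_e i)) k"
    using assms by (auto simp: sum.delta')
qed

lemma brk_table_basis:
  assumes "i \<in> {1..d}" "j \<in> {1..d}"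
  shows "brk (table_algebra d t) (basis_e i) (basis_e j) = t i j"
proof
  fix k
  have "brk (table_algebra d t) (basis_e i) (basis_e j) k =
      (\<Sum>i'=1..d. \<Sum>j'=1..d. if j' = j then if i' = i then t i' j' k else 0 else 0)"
    unfolding brk_table by (intro sum.cong) (auto simp: basis_e_def)
  also have "\<dots> = t i j k" using assms by (simp add: sum.delta)
  finally show "brk (table_algebra d t) (basis_e i) (basis_e j) k = t i j k" .
qed

lemma fd_table_algebra:
  assumes t: "\<And>i j k. i \<in> {1..d} \<Longrightarrow> j \<in> {1..d} \<Longrightarrow> k \<notin> {1..d} \<Longrightarrow> t i j k = 0"
  shows "fd_algebra (table_algebra d t)"
proof -
  let ?A = "table_algebra d t"
  interpret vector_space fun_scale by (rule vector_space_fun)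
  have sub: "subspace (carr ?A)"
    unfolding subspace_def by (auto simp: carr_table fun_scale_def)
  have "basis_e ` {1..d} \<subseteq> carr ?A" by (auto simp: carr_table basis_e_def)
  then have "span (basis_e ` {1..d}) \<subseteq> carr ?A" using sub by (rule span_minimal)
  moreover have "carr ?A \<subseteq> span (basis_e ` {1..d})"
  proof
    fix x assume "x \<in> carr ?A"
    then have "x = (\<Sum>i\<in>{1..d}. fun_scale (x i) (basis_e i))"
      by (intro basis_expansion) (auto simp: carr_table)
    also have "\<dots> \<in> span (basis_e ` {1..d})"
      by (intro span_sum span_scale span_base) auto
    finally show "x \<in> span (basis_e ` {1..d})" .
  qed
  ultimately have sp: "carr ?A = span (basis_e ` {1..d})" by blast
  show ?thesis
    unfolding fd_algebra_def scl_table
  proof (intro conjI ballI allI)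
    show "vector_space fun_scale" by (rule vector_space_fun)
    show "subspace (carr ?A)" by (rule sub)
    show "\<exists>B. finite B \<and> carr ?A = span B" using sp by blast
  next
    fix x y show "brk ?A x y \<in> carr ?A"
      unfolding carr_table mem_Collect_eq brk_table using t by (auto intro!: sum.neutral)
  next
    fix x y z
    show "brk ?A (x + y) z = brk ?A x z + brk ?A y z" "brk ?A x (y + z) = brk ?A x y + brk ?A x z"
      by (simp_all add: fun_eq_iff brk_table distrib_left distrib_right sum.distrib)
  next
    fix c x y
    have "c * x i * y j * t i j k = c * (x i * y j * t i j k)"
      "x i * (c * y j) * t i j k = c * (x i * y j * t i j k)" for i j k by simp_all
    then show "brk ?A (fun_scale c x) y = fun_scale c (brk ?A x y)"
      "brk ?A x (fun_scale c y) = fun_scale c (brk ?A x y)"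
      unfolding fun_eq_iff brk_table fun_scale_def by (simp_all only: sum_distrib_left simp_thms)
  qed
qed

lemma brk_lincomb_lincomb:
  assumes E: "fd_algebra E" and g: "\<And>i. i \<in> I \<Longrightarrow> g i \<in> carr E" and h: "\<And>j. j \<in> J \<Longrightarrow> h j \<in> carr E"
  shows "brk E (\<Sum>i\<in>I. scl E (x i) (g i)) (\<Sum>j\<in>J. scl E (y j) (h j)) =
    (\<Sum>i\<in>I. scl E (x i) (\<Sum>j\<in>J. scl E (y j) (brk E (g i) (h j))))"
proof -
  have "(\<Sum>j\<in>J. scl E (y j) (h j)) \<in> carr E"
    using h by (intro fd_sum[OF E] fd_scl[OF E])
  then have "brk E (\<Sum>i\<in>I. scl E (x i) (g i)) (\<Sum>j\<in>J. scl E (y j) (h j)) =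
    (\<Sum>i\<in>I. scl E (x i) (brk E (g i) (\<Sum>j\<in>J. scl E (y j) (h j))))"
    using g by (rule brk_lincomb_left[OF E])
  also have "\<dots> = (\<Sum>i\<in>I. scl E (x i) (\<Sum>j\<in>J. scl E (y j) (brk E (g i) (h j))))"
    by (intro sum.cong refl arg_cong[where f = "scl E _"] brk_lincomb_right[OF E] g h)
  finally show ?thesis .
qed

text \<open>
  Both sides of the multiplicativity condition are bilinear in the coefficients, so comparing products of
  the \<open>g i\<close> suffices.
\<close>

lemma table_algebra_hom:
  assumes E: "fd_algebra E" and g: "\<And>i. i \<in> {1..d} \<Longrightarrow> g i \<in> carr E"
    and tab: "\<And>i j. i \<in> {1..d} \<Longrightarrow> j \<in> {1..d} \<Longrightarrow>
                brk E (g i) (g j) = (\<Sum>k=1..d. scl E (t i j k) (g k))"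
  shows "alg_hom (table_algebra d t) E (\<lambda>x. \<Sum>i=1..d. scl E (x i) (g i))"
proof -
  interpret vector_space "scl E" using E by (rule fd_vector_space)
  show ?thesis
    unfolding alg_hom_def scl_table
  proof (intro conjI ballI allI)
    fix x :: "nat \<Rightarrow> complex"
    show "(\<Sum>i=1..d. scl E (x i) (g i)) \<in> carr E"
      using g by (intro fd_sum[OF E] fd_scl[OF E])
    fix y :: "nat \<Rightarrow> complex"
    show "(\<Sum>i=1..d. scl E ((x + y) i) (g i))
        = (\<Sum>i=1..d. scl E (x i) (g i)) + (\<Sum>i=1..d. scl E (y i) (g i))"
      by (simp add: scale_left_distrib sum.distrib)
    have "brk E (\<Sum>i=1..d. scl E (x i) (g i)) (\<Sum>j=1..d. scl E (y j) (g j)) =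
        (\<Sum>i=1..d. scl E (x i) (\<Sum>j=1..d. scl E (y j) (brk E (g i) (g j))))"
      by (rule brk_lincomb_lincomb[OF E g g])
    also have "\<dots> = (\<Sum>i=1..d. \<Sum>j=1..d. \<Sum>k=1..d. scl E (x i * y j * t i j k) (g k))"
      by (simp add: tab scale_sum_right mult.assoc)
    also have "\<dots> = (\<Sum>i=1..d. \<Sum>k=1..d. \<Sum>j=1..d. scl E (x i * y j * t i j k) (g k))"
      by (intro sum.cong refl sum.swap)
    also have "\<dots> = (\<Sum>k=1..d. \<Sum>i=1..d. \<Sum>j=1..d. scl E (x i * y j * t i j k) (g k))"
      by (rule sum.swap)
    also have "\<dots> = (\<Sum>k=1..d. scl E (brk (table_algebra d t) x y k) (g k))"
      by (simp add: brk_table scale_sum_left)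
    finally show "(\<Sum>k=1..d. scl E (brk (table_algebra d t) x y k) (g k)) =
        brk E (\<Sum>i=1..d. scl E (x i) (g i)) (\<Sum>i=1..d. scl E (y i) (g i))" by simp
  next
    fix c and x :: "nat \<Rightarrow> complex"
    show "(\<Sum>i=1..d. scl E (fun_scale c x i) (g i)) = scl E c (\<Sum>i=1..d. scl E (x i) (g i))"
      by (simp add: fun_scale_def scale_sum_right)
  qed
qed

lemma lincomb_basis_e:
  assumes "vector_space s" "finite I" "m \<in> I"
  shows "(\<Sum>k\<in>I. s (basis_e m k) (g k)) = g m"
proof -
  interpret vector_space s by (rule assms(1))
  have "(\<Sum>k\<in>I. s (basis_e m k) (g k)) = (\<Sum>k\<in>I. if k = m then g k else 0)"
    by (intro sum.cong) (auto simp: basis_e_def)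
  then show ?thesis using assms(2,3) by simp
qed

section \<open>The target algebra\<close>

definition ext4_table :: "nat \<Rightarrow> nat \<Rightarrow> nat \<Rightarrow> nat \<Rightarrow> complex" where
  "ext4_table n i j =
    (if 1 \<le> i \<and> i \<le> n - 2 \<and> j = 1 then basis_e (i + 1)
     else if i = n - 1 \<and> j = 1 then basis_e (n + 2)
     else if i = n \<and> j = 1 then basis_e (n + 1)
     else if i = 1 \<and> j = n then basis_e (n + 3)
     else if i = n \<and> j = n then basis_e (n + 4)
     else 0)"

lemma ext4_F2_eq: "ext4_F2 n = table_algebra (n + 4) (ext4_table n)"
  by (simp add: ext4_F2_def ext4_table_def[abs_def])

text \<open>
  The basis vectors missing from the right-hand side are \<open>e\<^sub>1\<close> and \<open>e\<^sub>n\<close>, the generators of the algebra.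
  This is what bounds the derived subspace of an extension from above.
\<close>

lemma ext4_table_entry:
  assumes "i \<ge> 1"
  shows "ext4_table n i j \<in> insert 0 (basis_e ` ({2..n - 1} \<union> {n + 1..n + 4}))"
proof -
  have if_in: "(if c then x else y) \<in> S" if "c \<Longrightarrow> x \<in> S" "\<not> c \<Longrightarrow> y \<in> S"
    for c and x y :: "nat \<Rightarrow> complex" and S using that by simp
  show ?thesis
    unfolding ext4_table_def
    by (intro if_in insertI1; intro insertI2 imageI) (use assms in auto)
qed

lemma fd_ext4_F2: "fd_algebra (ext4_F2 n)"
  unfolding ext4_F2_eq
proof (rule fd_table_algebra)
  fix i j k :: nat assume "i \<in> {1..n + 4}" "k \<notin> {1..n + 4}"
  then show "ext4_table n i j k = 0"
    using ext4_table_entry[of i n j] by (auto simp: basis_e_def)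
qed

section \<open>Central extensions of \<open>F2 n\<close>\<close>

text \<open>
  The vectors \<open>a\<close> and \<open>b\<close> are arbitrary lifts of the two generators \<open>e\<^sub>1\<close> and \<open>e\<^sub>2\<close> of \<open>F2 n\<close>. The
  dimension of the kernel is left open, since the multiplication rules hold for every central
  extension.
\<close>

locale F2_central_extension =
  fixes n :: nat and E :: "('a::ab_group_add) calg" and p :: "'a \<Rightarrow> nat \<Rightarrow> complex" and a b :: 'a
  assumes n: "n \<ge> 3"
    and leibE: "leibniz_algebra E"
    and leibL: "leibniz_algebra (F2 n)"
    and p: "alg_hom E (F2 n) p"
    and central: "{x \<in> carr E. p x = 0} \<subseteq> alg_center E"
    and a: "a \<in> carr E" "p a = basis_e 1"
    and b: "b \<in> carr E" "p b = basis_e 2"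
begin

lemma E: "fd_algebra E" and L: "fd_algebra (F2 n)"
  using leibE leibL by (auto simp: leibniz_algebra_def)

sublocale E: vector_space "scl E" by (rule fd_vector_space[OF E])

lemma scl_F2: "scl (F2 n) = fun_scale"
  by (simp add: F2_def scl_table)

lemma leibniz: "x \<in> carr E \<Longrightarrow> y \<in> carr E \<Longrightarrow> z \<in> carr E \<Longrightarrow>
    brk E x (brk E y z) = brk E (brk E x y) z - brk E (brk E x z) y"
  using leibE by (simp add: leibniz_algebra_def)

abbreviation K where "K \<equiv> {x \<in> carr E. p x = 0}"

lemma brk_K: "k \<in> K \<Longrightarrow> x \<in> carr E \<Longrightarrow> brk E x k = 0" "k \<in> K \<Longrightarrow> x \<in> carr E \<Longrightarrow> brk E k x = 0"
  using central by (auto simp: alg_center_def)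

lemma F2_basis:
  assumes "i \<in> {1..n}" "j \<in> {1..n}"
  shows "brk (F2 n) (basis_e i) (basis_e j) =
    (if i = 1 \<and> j = 1 then basis_e 3
     else if 3 \<le> i \<and> i \<le> n - 1 \<and> j = 1 then basis_e (i + 1) else 0)"
  unfolding F2_def using brk_table_basis[OF assms] by simp

text \<open>
  The vector \<open>e\<^sub>2\<close> spans an abelian direct summand of \<open>F2 n\<close>.
\<close>

lemma F2_e2:
  assumes "x \<in> carr (F2 n)"
  shows "brk (F2 n) x (basis_e 2) = 0" "brk (F2 n) (basis_e 2) x = 0"
  using n by (auto simp: F2_def fun_eq_iff brk_table basis_e_def intro!: sum.neutral)

text \<open>
  Iterated right multiplication lifts the chain \<open>e\<^sub>1, e\<^sub>3, \<dots>, e\<^sub>n\<close> of \<open>F2 n\<close> to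
  \<open>chain 1, \<dots>, chain (n - 1)\<close>; its next member, \<open>chain n\<close>, is the first one that lies in the kernel.
\<close>

definition chain where "chain i = ((\<lambda>x. brk E x a) ^^ (i - 1)) a"

lemma chain_1: "chain (Suc 0) = a"
  and chain_Suc: "i \<ge> 1 \<Longrightarrow> chain (Suc i) = brk E (chain i) a"
  by (cases i; simp add: chain_def)+

lemma chain_carr: "i \<ge> 1 \<Longrightarrow> chain i \<in> carr E"
  by (induction i rule: nat_induct_at_least) (use a in \<open>auto simp: chain_1 chain_Suc fd_brk[OF E]\<close>)

text \<open>
  A bracket \<open>[y, a]\<close> multiplies from the right as the commutator of the right multiplications by \<open>y\<close> and
  \<open>a\<close>. For \<open>y = a\<close> this is zero, and if right multiplication by \<open>y\<close> is zero, so is the commutator.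
\<close>

lemma brk_chain:
  assumes "j \<ge> 2" "x \<in> carr E"
  shows "brk E x (chain j) = 0"
  using assms
proof (induction j arbitrary: x rule: nat_induct_at_least)
  case base
  then show ?case
    using a leibniz[of x a a] by (simp add: chain_1 chain_Suc numeral_2_eq_2)
next
  case (Suc j)
  then show ?case
    using a leibniz[of x "chain j" a] chain_carr[of j]
    by (simp add: chain_Suc fd_brk[OF E] brk_zero_left[OF E])
qed

lemma p_chain: "i \<ge> 2 \<Longrightarrow> i \<le> n - 1 \<Longrightarrow> p (chain i) = basis_e (i + 1)"
proof (induction i rule: nat_induct_at_least)
  case base
  then show ?case
    using a n F2_basis[of 1 1] by (simp add: chain_1 chain_Suc numeral_2_eq_2 hom_brk[OF p] numeral_3_eq_3)
next
  case (Suc i)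
  then show ?case
    using a n F2_basis[of "i + 1" 1] chain_carr[of i] by (simp add: chain_Suc hom_brk[OF p])
qed

lemma p_chain_n: "p (chain n) = 0"
proof -
  have "chain n = brk E (chain (n - 1)) a" using chain_Suc[of "n - 1"] n by simp
  then show ?thesis
    using p_chain[of "n - 1"] a n F2_basis[of n 1] chain_carr[of "n - 1"]
    by (auto simp: hom_brk[OF p])
qed

lemma brk_b_K:
  assumes "x \<in> carr E"
  shows "brk E x b \<in> K" "brk E b x \<in> K"
  using assms b F2_e2[OF hom_carr[OF p assms]] by (auto simp: hom_brk[OF p] fd_brk[OF E])

text \<open>
  In the Leibniz identity for \<open>[chain j, [b, a]]\<close>, both \<open>[b, a]\<close> and \<open>[chain j, b]\<close> are central, because
  \<open>e\<^sub>2\<close> annihilates \<open>F2 n\<close>; only \<open>[chain (j + 1), b]\<close> survives.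
\<close>

lemma brk_chain_b:
  assumes "i \<ge> 2"
  shows "brk E (chain i) b = 0"
proof -
  obtain j where j: "i = Suc j" "j \<ge> 1" using assms by (cases i) auto
  have c: "chain j \<in> carr E" using j chain_carr by auto
  have "brk E (chain j) (brk E b a) = brk E (brk E (chain j) b) a - brk E (brk E (chain j) a) b"
    using c a b by (intro leibniz) auto
  moreover have "brk E (chain j) (brk E b a) = 0" by (rule brk_K(1)[OF brk_b_K(2)[OF a(1)] c])
  moreover have "brk E (brk E (chain j) b) a = 0" by (rule brk_K(2)[OF brk_b_K(1)[OF c] a(1)])
  ultimately show ?thesis using j by (simp add: chain_Suc)
qed

text \<open>
  These are the intended images of the basis vectors of \<open>ext4_F2 n\<close>: the lifted chain and \<open>b\<close>, followed by
  the four elements of the kernel that the cocycle identity leaves unconstrained.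
\<close>

definition gen where
  "gen i = (if i \<le> n - 1 then chain i
     else if i = n then b
     else if i = n + 1 then brk E b a
     else if i = n + 2 then chain n
     else if i = n + 3 then brk E a b
     else brk E b b)"

lemma gen_chain: "i \<le> n - 1 \<Longrightarrow> gen i = chain i"
  by (simp add: gen_def)

lemma gen_values:
  "gen n = b" "gen (n + 1) = brk E b a" "gen (n + 2) = chain n"
  "gen (n + 3) = brk E a b" "gen (n + 4) = brk E b b"
  using n by (auto simp: gen_def)

lemma gen_carr: "i \<ge> 1 \<Longrightarrow> gen i \<in> carr E"
  using n a b chain_carr by (auto simp: gen_def fd_brk[OF E])

lemma gen_K:
  assumes "i \<ge> n + 1"
  shows "gen i \<in> K"
proof -
  have "chain n \<in> K" using n p_chain_n chain_carr[of n] by simp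
  moreover have "\<not> i \<le> n - 1" "i \<noteq> n" using assms by auto
  ultimately show ?thesis
    using brk_b_K[OF a(1)] brk_b_K[OF b(1)] unfolding gen_def by (simp only: if_False split: if_split) blast
qed

text \<open>
  The products that vanish do so for one of three reasons: a factor in the kernel, a right factor
  \<open>chain j\<close> with \<open>j \<ge> 2\<close>, or the right factor \<open>b\<close> after such a chain element. All others are generators by
  definition.
\<close>

lemma brk_gen:
  assumes i: "i \<in> {1..n + 4}" and j: "j \<in> {1..n + 4}"
  shows "brk E (gen i) (gen j) = (\<Sum>k=1..n + 4. scl E (ext4_table n i j k) (gen k))"
proof -
  have sum: "(\<Sum>k=1..n + 4. scl E (basis_e m k) (gen k)) = gen m" if "m \<in> {1..n + 4}" for m
    using that by (intro lincomb_basis_e[OF E.vector_space_axioms]) auto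
  consider "i \<ge> n + 1 \<or> j \<ge> n + 1" | "i \<le> n" "2 \<le> j" "j \<le> n - 1" | "i \<le> n" "j = 1"
    | "i \<le> n" "j = n" using j by fastforce
  then show ?thesis
  proof cases
    case 1
    then have "brk E (gen i) (gen j) = 0" using brk_K gen_K gen_carr i j by (auto simp del: mem_Collect_eq)
    moreover have "ext4_table n i j = 0" using 1 n by (auto simp: ext4_table_def)
    ultimately show ?thesis by simp
  next
    case 2
    then have "brk E (gen i) (gen j) = 0" using brk_chain gen_carr i by (auto simp: gen_def[of j])
    moreover have "ext4_table n i j = 0" using 2 n by (auto simp: ext4_table_def)
    ultimately show ?thesis by simp
  next
    case 3
    have gj: "gen j = a" using 3 n chain_1 gen_chain[of 1] by simp
    consider "i \<le> n - 2" | "i = n - 1" | "i = n" using 3 by linarith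
    then show ?thesis
    proof cases
      case 1
      have t: "ext4_table n i j = basis_e (i + 1)" using i 1 3 n by (simp add: ext4_table_def)
      have "brk E (gen i) (gen j) = chain (i + 1)"
        using i 1 n gj chain_Suc[of i] gen_chain[of i] by auto
      also have "\<dots> = gen (i + 1)" using 1 n by (intro gen_chain[symmetric]) auto
      finally show ?thesis using sum[of "i + 1"] i 1 unfolding t by auto
    next
      case 2
      have t: "ext4_table n i j = basis_e (n + 2)" using 2 3 n by (auto simp: ext4_table_def)
      have "brk E (gen i) (gen j) = gen (n + 2)"
        using 2 n gj chain_Suc[of "n - 1"] gen_chain[of i] gen_values by auto
      then show ?thesis using sum[of "n + 2"] unfolding t by simp
    next
      case 3
      then have t: "ext4_table n i j = basis_e (n + 1)" using \<open>j = 1\<close> n by (auto simp: ext4_table_def)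
      show ?thesis using sum[of "n + 1"] gj gen_values t 3 by simp
    qed
  next
    case 4
    consider "i = 1" | "2 \<le> i" "i \<le> n - 1" | "i = n" using 4 i by fastforce
    then show ?thesis
    proof cases
      case 1
      then have t: "ext4_table n i j = basis_e (n + 3)" using 4 n by (auto simp: ext4_table_def)
      have "gen i = a" using 1 n chain_1 gen_chain[of 1] by simp
      then show ?thesis using sum[of "n + 3"] 4 gen_values unfolding t by simp
    next
      case 2
      then have "ext4_table n i j = 0" using 4 n by (auto simp: ext4_table_def)
      then show ?thesis using brk_chain_b[of i] 2 4 gen_chain[of i] gen_values by simp
    next
      case 3
      then have t: "ext4_table n i j = basis_e (n + 4)" using 4 n by (auto simp: ext4_table_def)
      show ?thesis using sum[of "n + 4"] 4 gen_values t 3 by simp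
    qed
  qed
qed

text \<open>
  The projection sends \<open>gen i\<close> to the basis vector with number \<open>image_index i\<close>: in \<open>F2 n\<close> the number 2 is
  skipped by the chain, and it belongs to the image of \<open>b = gen n\<close>.
\<close>

definition image_index :: "nat \<Rightarrow> nat" where "image_index i = (if i = 1 then 1 else if i = n then 2 else i + 1)"

lemma bij_image_index: "bij_betw image_index {1..n} {1..n}"
proof -
  have "inj_on image_index {1..n}" using n by (auto simp: inj_on_def image_index_def split: if_splits)
  moreover have "image_index ` {1..n} \<subseteq> {1..n}" using n by (auto simp: image_index_def)
  ultimately show ?thesis by (simp add: bij_betw_def endo_inj_surj)
qed

lemma p_gen: "i \<in> {1..n} \<Longrightarrow> p (gen i) = basis_e (image_index i)"
  using n a b p_chain[of i] chain_1 by (cases "i = 1") (auto simp: gen_def image_index_def)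

lemma p_lincomb_gen:
  assumes "J \<subseteq> {1..n}" "i \<in> J"
  shows "p (\<Sum>i\<in>J. scl E (c i) (gen i)) (image_index i) = c i"
proof -
  have fin: "finite J" using assms(1) finite_subset by blast
  have gJ: "gen i \<in> carr E" if "i \<in> J" for i using that assms(1) gen_carr[of i] by auto
  have "p (\<Sum>i\<in>J. scl E (c i) (gen i)) (image_index i) = (\<Sum>i\<in>J. fun_scale (c i) (p (gen i))) (image_index i)"
    using hom_lincomb[OF E p, of J gen c] gJ unfolding scl_F2 by simp
  also have "\<dots> = (\<Sum>j\<in>J. if j = i then c j else 0)"
    unfolding sum_fun_apply
  proof (intro sum.cong refl)
    fix j assume j: "j \<in> J"
    then have "image_index j = image_index i \<longleftrightarrow> j = i"
      using assms bij_image_index by (auto simp: bij_betw_def inj_on_def)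
    then show "fun_scale (c j) (p (gen j)) (image_index i) = (if j = i then c j else 0)"
      using j assms(1) p_gen[of j] by (auto simp: fun_scale_def basis_e_def)
  qed
  finally show ?thesis using fin assms(2) by simp
qed

lemma lift_decomposition:
  assumes y: "y \<in> carr E"
  obtains c k where "k \<in> K" "y = (\<Sum>i=1..n. scl E (c i) (gen i)) + k"
proof -
  \<comment> \<open>The coefficients of \<open>p y\<close>, renumbered, give a combination of lifts with the same image.\<close>
  define c where "c i = p y (image_index i)" for i
  let ?u = "\<Sum>i=1..n. scl E (c i) (gen i)"
  have u: "?u \<in> carr E" using gen_carr by (intro fd_sum[OF E] fd_scl[OF E]) auto
  have supp: "v k = 0" if "v \<in> carr (F2 n)" "k \<notin> {1..n}" for v k
    using that by (auto simp: F2_def carr_table)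
  have "p ?u = p y"
  proof
    fix k
    show "p ?u k = p y k"
    proof (cases "k \<in> {1..n}")
      case True
      then obtain i where "i \<in> {1..n}" "k = image_index i"
        using bij_betw_imp_surj_on[OF bij_image_index] by (metis imageE)
      then show ?thesis using p_lincomb_gen[of "{1..n}" i c] by (simp add: c_def)
    next
      case False
      then show ?thesis using supp[OF hom_carr[OF p u]] supp[OF hom_carr[OF p y]] by metis
    qed
  qed
  then have "y - ?u \<in> K" using y u by (simp add: hom_diff[OF E p] fd_diff[OF E])
  then show thesis using that[of "y - ?u" c] by simp
qed

definition bracket_span where "bracket_span = E.span (gen ` ({2..n - 1} \<union> {n + 1..n + 4}))"

text \<open>
  Central summands do not contribute to brackets, so only the lifts \<open>gen 1, \<dots>, gen n\<close> matter, and their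
  products are read off from the table.
\<close>

lemma brk_in_bracket_span:
  assumes "x \<in> carr E" "y \<in> carr E"
  shows "brk E x y \<in> bracket_span"
proof -
  have gD: "brk E (gen i) (gen j) \<in> bracket_span" if "i \<in> {1..n}" "j \<in> {1..n}" for i j
  proof -
    have "ext4_table n i j \<in> insert 0 (basis_e ` ({2..n - 1} \<union> {n + 1..n + 4}))"
      using that(1) by (intro ext4_table_entry) simp
    then consider "ext4_table n i j = 0"
      | m where "m \<in> {2..n - 1} \<union> {n + 1..n + 4}" "ext4_table n i j = basis_e m"
      by blast
    then show ?thesis
    proof cases
      case 1
      then show ?thesis using brk_gen[of i j] that by (simp add: bracket_span_def E.span_zero)
    next
      case (2 m)
      have "brk E (gen i) (gen j) = gen m"
        using 2 that brk_gen[of i j] lincomb_basis_e[OF E.vector_space_axioms, of "{1..n + 4}" m gen] n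
        by auto
      then show ?thesis unfolding bracket_span_def using 2 by (auto intro: E.span_base)
    qed
  qed
  obtain c k where x: "k \<in> K" "x = (\<Sum>i=1..n. scl E (c i) (gen i)) + k"
    using lift_decomposition[OF assms(1)] .
  obtain c' k' where y: "k' \<in> K" "y = (\<Sum>i=1..n. scl E (c' i) (gen i)) + k'"
    using lift_decomposition[OF assms(2)] .
  let ?u = "\<Sum>i=1..n. scl E (c i) (gen i)" and ?v = "\<Sum>i=1..n. scl E (c' i) (gen i)"
  have u: "?u \<in> carr E" "?v \<in> carr E" using gen_carr by (auto intro!: fd_sum[OF E] fd_scl[OF E])
  have "brk E x y = brk E ?u y"
    using x u assms brk_K[OF x(1)] by (simp add: brk_add_left[OF E])
  also have "\<dots> = brk E ?u ?v"
    using y u brk_K[OF y(1)] by (simp add: brk_add_right[OF E])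
  also have "\<dots> = (\<Sum>i=1..n. scl E (c i) (\<Sum>j=1..n. scl E (c' j) (brk E (gen i) (gen j))))"
    using gen_carr by (intro brk_lincomb_lincomb[OF E]) auto
  also have "\<dots> \<in> bracket_span"
    using gD unfolding bracket_span_def by (intro E.span_sum E.span_scale) auto
  finally show ?thesis .
qed

text \<open>
  Projecting a combination of the spanning vectors of \<open>bracket_span\<close> leaves a combination of distinct
  basis vectors of \<open>F2 n\<close>, with the coefficients of \<open>gen 2, \<dots>, gen (n - 1)\<close>. On the kernel these
  coefficients vanish, and only the four central generators remain.
\<close>

lemma kernel_eq_span:
  assumes "K \<subseteq> bracket_span"
  shows "K = E.span (gen ` {n + 1..n + 4})"
proof
  show "E.span (gen ` {n + 1..n + 4}) \<subseteq> K"
    using gen_K kernel_subspace[OF E L p] by (intro E.span_minimal) auto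
  show "K \<subseteq> E.span (gen ` {n + 1..n + 4})"
  proof
    fix x assume x: "x \<in> K"
    then have "x \<in> bracket_span" using assms by blast
    then obtain c where "x = (\<Sum>i\<in>{2..n - 1} \<union> {n + 1..n + 4}. scl E (c i) (gen i))"
      unfolding bracket_span_def by (rule span_family[OF E.vector_space_axioms, rotated]) auto
    also have "\<dots> = (\<Sum>i=2..n - 1. scl E (c i) (gen i)) + (\<Sum>i=n + 1..n + 4. scl E (c i) (gen i))"
      by (intro sum.union_disjoint) auto
    finally have eq: "x = (\<Sum>i=2..n - 1. scl E (c i) (gen i)) + (\<Sum>i=n + 1..n + 4. scl E (c i) (gen i))"
      (is "x = ?u + ?w") .
    have w: "?w \<in> E.span (gen ` {n + 1..n + 4})"
      by (intro E.span_sum E.span_scale E.span_base) auto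
    then have wK: "?w \<in> K" using \<open>E.span (gen ` {n + 1..n + 4}) \<subseteq> K\<close> by blast
    have u: "?u \<in> carr E" using gen_carr by (intro fd_sum[OF E] fd_scl[OF E]) auto
    have "p ?u = 0" using x wK u hom_add[OF p u, of ?w] by (simp add: eq)
    then have "c i = 0" if "i \<in> {2..n - 1}" for i
      using p_lincomb_gen[of "{2..n - 1}" i c] that by auto
    then have "?u = 0" by (intro sum.neutral) auto
    then show "x \<in> E.span (gen ` {n + 1..n + 4})" using eq w by simp
  qed
qed

text \<open>
  Four vectors spanning a kernel of dimension 4 are independent. Adding the lifts of a basis of \<open>F2 n\<close>
  gives a basis of \<open>E\<close> with the required multiplication table.
\<close>

lemma iso_ext4:
  assumes K_sub: "K \<subseteq> bracket_span" and dim: "E.dim K = 4"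
  shows "E \<cong>\<^sub>a ext4_F2 n"
proof -
  let ?M = "{n + 1..n + 4}"
  let ?f = "\<lambda>x. \<Sum>i=1..n + 4. scl E (x i) (gen i)"
  have hom: "alg_hom (ext4_F2 n) E ?f"
    unfolding ext4_F2_eq using gen_carr brk_gen by (intro table_algebra_hom[OF E]) auto
  have K: "K = E.span (gen ` ?M)" by (rule kernel_eq_span[OF K_sub])
  then have dimM: "E.dim (gen ` ?M) = card ?M" using dim unfolding K by simp
  have split: "?f x = (\<Sum>i=1..n. scl E (x i) (gen i)) + (\<Sum>i\<in>?M. scl E (x i) (gen i))" for x
    using sum.ub_add_nat[of 1 n "\<lambda>i. scl E (x i) (gen i)" 4] by simp
  have wK: "(\<Sum>i\<in>?M. scl E (x i) (gen i)) \<in> K" for x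
    unfolding K by (intro E.span_sum E.span_scale E.span_base) auto
  have uE: "(\<Sum>i=1..n. scl E (x i) (gen i)) \<in> carr E" for x
    using gen_carr by (intro fd_sum[OF E] fd_scl[OF E]) auto
  have ker: "x = 0" if x: "x \<in> carr (ext4_F2 n)" "?f x = 0" for x
  proof -
    have "p (\<Sum>i=1..n. scl E (x i) (gen i)) = p (?f x)"
      using uE[of x] wK[of x] hom_add[OF p uE[of x], of "\<Sum>i\<in>?M. scl E (x i) (gen i)"]
      by (simp only: split) simp
    then have "p (\<Sum>i=1..n. scl E (x i) (gen i)) = 0"
      using x(2) hom_zero[OF E p] by simp
    then have low: "x i = 0" if "i \<in> {1..n}" for i
      using p_lincomb_gen[of "{1..n}" i x] that by auto
    then have "(\<Sum>i=1..n. scl E (x i) (gen i)) = 0" by (intro sum.neutral) auto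
    then have "(\<Sum>i\<in>?M. scl E (x i) (gen i)) = 0" using x(2) split[of x] by simp
    then have high: "x i = 0" if "i \<in> ?M" for i
      using that family_independent[OF E.vector_space_axioms _ dimM] by auto
    show ?thesis
    proof
      fix i
      consider "i \<in> {1..n}" | "i \<in> ?M" | "i \<notin> {1..n + 4}" by fastforce
      then show "x i = 0 i"
        using low high x(1) by cases (auto simp: ext4_F2_eq carr_table)
    qed
  qed
  have inj: "inj_on ?f (carr (ext4_F2 n))"
  proof (rule inj_onI)
    fix x y assume xy: "x \<in> carr (ext4_F2 n)" "y \<in> carr (ext4_F2 n)" "?f x = ?f y"
    then have "?f (x - y) = 0" using hom_diff[OF fd_ext4_F2 hom] by simp
    then have "x - y = 0" using xy fd_diff[OF fd_ext4_F2] ker by blast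
    then show "x = y" by simp
  qed
  have "carr E \<subseteq> ?f ` carr (ext4_F2 n)"
  proof
    fix y assume "y \<in> carr E"
    then obtain c k where y: "k \<in> K" "y = (\<Sum>i=1..n. scl E (c i) (gen i)) + k"
      by (rule lift_decomposition)
    obtain c' where k: "k = (\<Sum>i\<in>?M. scl E (c' i) (gen i))"
      using y(1) unfolding K by (rule span_family[OF E.vector_space_axioms, rotated]) auto
    let ?x = "\<lambda>i. if i \<in> {1..n} then c i else if i \<in> ?M then c' i else 0"
    have "?f ?x = (\<Sum>i=1..n. scl E (c i) (gen i)) + (\<Sum>i\<in>?M. scl E (c' i) (gen i))"
      unfolding split by (intro arg_cong2[where f = "(+)"] sum.cong) auto
    moreover have "?x \<in> carr (ext4_F2 n)" by (auto simp: ext4_F2_eq carr_table)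
    ultimately show "y \<in> ?f ` carr (ext4_F2 n)" using y k by (intro image_eqI[of _ _ ?x]) simp_all
  qed
  then have bij: "bij_betw ?f (carr (ext4_F2 n)) (carr E)"
    using inj hom_carr[OF hom] by (auto simp: bij_betw_def)
  show ?thesis
    unfolding alg_iso_def
    using inv_into_hom[OF fd_ext4_F2 hom bij] bij_betw_inv_into[OF bij] by blast
qed

end

theorem theorem4p9:
  fixes n :: nat and E :: "('a::ab_group_add) calg"
  assumes "n \<ge> 3"
    and "nonsplit_extension 4 E (F2 n)"
  shows "E \<cong>\<^sub>a ext4_F2 n"
proof -
  have "central_extension 4 E (F2 n)"
    using assms(2) by (simp add: nonsplit_extension_def)
  then obtain p where ext: "leibniz_algebra E" "leibniz_algebra (F2 n)" "alg_hom E (F2 n) p"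
    "p ` carr E = carr (F2 n)" "{x \<in> carr E. p x = 0} \<subseteq> alg_center E"
    "vector_space.dim (scl E) {x \<in> carr E. p x = 0} = 4"
    by (rule central_extensionE)
  have "basis_e 1 \<in> p ` carr E" "basis_e 2 \<in> p ` carr E"
    using assms(1) unfolding ext(4) by (auto simp: F2_def carr_table basis_e_def)
  then obtain a b where ab: "a \<in> carr E" "p a = basis_e 1" "b \<in> carr E" "p b = basis_e 2"
    by (metis imageE)
  interpret F2_central_extension n E p a b
    by unfold_locales (use assms(1) ext ab in auto)
  have "K \<subseteq> bracket_span"
  proof (rule nonsplit_kernel_subset_derived)
    show "nonsplit_extension (Suc 3) E (F2 n)" using assms(2) by simp
    show "E.subspace bracket_span" by (simp add: bracket_span_def)
  qed (use ext brk_in_bracket_span in auto)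
  then show ?thesis using ext(6) by (intro iso_ext4)
qed

end
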